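(* If $(L_t)$ is a supermartingale under two laws $\mathtt{Q},\mathtt{Q}'$ on $\mathcal{X}^{\mathbb{N}}$, then $(L_t)$ is also a supermartingale under every fork-convex combination $\mathtt{Q}''$ of $\mathtt{Q}$ and $\mathtt{Q}'$.
   Context: $\mathcal{X}$ is the space in which the data $(X_t)_{t\ge1}$ take values; $(X_t)_{t\ge1}$ are the coordinates on the sequence space $\mathcal{X}^{\mathbb{N}}$, $\mathcal{F}_0$ is trivial, $\mathcal{F}_t=\sigma(X_1,\dots,X_t)$; all (super)martingales are with respect to $(\mathcal{F}_t)_{t\ge0}$. A law $\mathtt{P}$ is locally dominated by a probability measure $\mathtt{R}$ (the reference measure) if $\mathtt{P}|_{\mathcal{F}_t}\ll\mathtt{R}|_{\mathcal{F}_t}$ for all $t\in\mathbb{N}$; its likelihood ratio process is then the $\mathtt{R}$-martingale $Z_t=\mathrm{d}\mathtt{P}|_{\mathcal{F}_t}/\mathrm{d}\mathtt{R}|_{\mathcal{F}_t}$. Any two laws $\mathtt{Q},\mathtt{Q}'$ are dominated by, for example, $\mathtt{R}=(\mathtt{Q}+\mathtt{Q}')/2$. Given a reference measure $\mathtt{R}$, a fork-convex combination of two locally dominated laws $\mathtt{Q},\mathtt{Q}'$ with likelihood ratio processes $(Z_t),(Z'_t)$ is another law $\mathtt{Q}''$ with likelihood ratio process $$Z''_t=\begin{cases}Z_t,&t\le s,\\ hZ_t+(1-h)Z_s\dfrac{Z'_t}{Z'_s},&t>s,\end{cases}$$ for some $s\in\{0,1,2,\dots\}$ and some $\mathcal{F}_s$-measurable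 random variable $h$ with values in $[0,1]$ and $h=1$ on $\{Z'_s=0\}$ (with the convention $0/0:=1$).
   Formalization: Since integrability can fail under Q'', the claim is proved for integrable supermartingales when the negative parts of each L_t are Q''-integrable, and without that condition for supermartingales in the generalized sense (one-step conditional expectations need only exist). *)

theory Defs
  imports "HOL-Probability.Probability"
begin

text \<open>The data take values in the measurable space \<open>M\<close> (only its sets matter) and are indexed by
  \<open>t \<ge> 1\<close>; the coordinate \<open>X\<^sub>t\<close> is \<open>\<lambda>\<omega>. \<omega> t\<close>.\<close>

definition seq_space :: "'a measure \<Rightarrow> (nat \<Rightarrow> 'a) measure" where
  "seq_space M = (\<Pi>\<^sub>M i\<in>{1..}. M)"

definition nat_filtration :: "'a measure \<Rightarrow> nat \<Rightarrow> (nat \<Rightarrow> 'a) measure" where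
  "nat_filtration M t =
     sigma (space (seq_space M))
       {(\<lambda>\<omega>. \<omega> i) -` A \<inter> space (seq_space M) | i A. i \<in> {1..t} \<and> A \<in> sets M}"

definition law :: "'a measure \<Rightarrow> (nat \<Rightarrow> 'a) measure \<Rightarrow> bool" where
  "law M P \<longleftrightarrow> prob_space P \<and> sets P = sets (seq_space M)"

definition locally_dominated ::
  "'a measure \<Rightarrow> (nat \<Rightarrow> 'a) measure \<Rightarrow> (nat \<Rightarrow> 'a) measure \<Rightarrow> bool" where
  "locally_dominated M R P \<longleftrightarrow>
     (\<forall>t. absolutely_continuous (restr_to_subalg R (nat_filtration M t))
                               (restr_to_subalg P (nat_filtration M t)))"

text \<open>\<open>Z\<close> is some version of the likelihood ratio process of \<open>P\<close> with respect to \<open>R\<close>: a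
  nonnegative, adapted process such that \<open>Z t\<close> is a density of \<open>P\<close> with respect to \<open>R\<close> on the
  time-\<open>t\<close> sigma-algebra. Versions are determined only up to \<open>R\<close>-null sets.\<close>

definition likelihood_ratio_process ::
  "'a measure \<Rightarrow> (nat \<Rightarrow> 'a) measure \<Rightarrow> (nat \<Rightarrow> 'a) measure \<Rightarrow> (nat \<Rightarrow> (nat \<Rightarrow> 'a) \<Rightarrow> real) \<Rightarrow> bool"
where
  "likelihood_ratio_process M R P Z \<longleftrightarrow>
     (\<forall>t. Z t \<in> borel_measurable (nat_filtration M t)
        \<and> (\<forall>\<omega>\<in>space (seq_space M). 0 \<le> Z t \<omega>)
        \<and> density (restr_to_subalg R (nat_filtration M t)) (\<lambda>\<omega>. ennreal (Z t \<omega>))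
            = restr_to_subalg P (nat_filtration M t))"

definition ratio :: "real \<Rightarrow> real \<Rightarrow> real" where
  "ratio a b = (if a = 0 \<and> b = 0 then 1 else a / b)"

definition fork_process ::
  "nat \<Rightarrow> ('w \<Rightarrow> real) \<Rightarrow> (nat \<Rightarrow> 'w \<Rightarrow> real) \<Rightarrow> (nat \<Rightarrow> 'w \<Rightarrow> real) \<Rightarrow> nat \<Rightarrow> 'w \<Rightarrow> real"
where
  "fork_process s h Z Z' t \<omega> =
     (if t \<le> s then Z t \<omega>
      else h \<omega> * Z t \<omega> + (1 - h \<omega>) * Z s \<omega> * ratio (Z' t \<omega>) (Z' s \<omega>))"

text \<open>Versions of the likelihood ratio processes are existentially quantified, so that the notion
  does not depend on a particular choice of versions.\<close>

definition fork_convex_combination ::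
  "'a measure \<Rightarrow> (nat \<Rightarrow> 'a) measure \<Rightarrow> (nat \<Rightarrow> 'a) measure \<Rightarrow> (nat \<Rightarrow> 'a) measure
     \<Rightarrow> (nat \<Rightarrow> 'a) measure \<Rightarrow> bool"
where
  "fork_convex_combination M R Q Q' Q'' \<longleftrightarrow>
     law M Q'' \<and> locally_dominated M R Q \<and> locally_dominated M R Q' \<and>
     (\<exists>Z Z' s h.
        likelihood_ratio_process M R Q Z \<and>
        likelihood_ratio_process M R Q' Z' \<and>
        h \<in> borel_measurable (nat_filtration M s) \<and>
        (\<forall>\<omega>\<in>space (seq_space M). 0 \<le> h \<omega> \<and> h \<omega> \<le> 1) \<and>
        (\<forall>\<omega>\<in>space (seq_space M). Z' s \<omega> = 0 \<longrightarrow> h \<omega> = 1) \<and>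
        likelihood_ratio_process M R Q'' (fork_process s h Z Z'))"

definition supermartingale ::
  "'a measure \<Rightarrow> (nat \<Rightarrow> 'a) measure \<Rightarrow> (nat \<Rightarrow> (nat \<Rightarrow> 'a) \<Rightarrow> real) \<Rightarrow> bool" where
  "supermartingale M P L \<longleftrightarrow>
     (\<forall>t. L t \<in> borel_measurable (nat_filtration M t)) \<and>
     (\<forall>t. integrable P (L t)) \<and>
     (\<forall>s t. s \<le> t \<longrightarrow> (AE \<omega> in P. real_cond_exp P (nat_filtration M s) (L t) \<omega> \<le> L s \<omega>))"

text \<open>Integrability need not pass to a fork-convex combination: it can fail if, under \<open>Q\<close>,
  \<open>X\<^sub>2 = 0\<close>, under \<open>Q'\<close>, \<open>X\<^sub>2 = \<plusminus>1\<close> is a fair coin independent of \<open>X\<^sub>1\<close>, and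
  \<open>L\<^sub>0 = L\<^sub>1 = 0\<close>, \<open>L\<^sub>t = f(X\<^sub>1) X\<^sub>2\<close> for \<open>t \<ge> 2\<close>, with \<open>f(X\<^sub>1)\<close> integrable under \<open>Q'\<close> but not under
  \<open>Q\<close> (take \<open>s = 1\<close>, \<open>h = 0\<close>). Hence also the notion of a generalized supermartingale: the
  one-step conditional expectations, the difference of the \<open>[0,\<infinity>]\<close>-valued conditional
  expectations of positive and negative part, are only required to exist. Here \<open>ennreal (L t \<omega>)\<close>
  is the positive and \<open>ennreal (- L t \<omega>)\<close> the negative part, as \<open>ennreal\<close> sends negative numbers
  to 0. In the example the two-step conditional expectation given the trivial sigma-algebra does
  not exist, so only one-step ones can be asked for.\<close>

definition gen_cond_exp :: "'w measure \<Rightarrow> 'w measure \<Rightarrow> ('w \<Rightarrow> real) \<Rightarrow> 'w \<Rightarrow> ereal" where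
  "gen_cond_exp P F f \<omega> =
     enn2ereal (nn_cond_exp P F (\<lambda>x. ennreal (f x)) \<omega>)
     - enn2ereal (nn_cond_exp P F (\<lambda>x. ennreal (- f x)) \<omega>)"

definition gen_cond_exp_exists :: "'w measure \<Rightarrow> 'w measure \<Rightarrow> ('w \<Rightarrow> real) \<Rightarrow> bool" where
  "gen_cond_exp_exists P F f \<longleftrightarrow>
     (AE \<omega> in P. nn_cond_exp P F (\<lambda>x. ennreal (f x)) \<omega> < \<infinity>
               \<or> nn_cond_exp P F (\<lambda>x. ennreal (- f x)) \<omega> < \<infinity>)"

definition generalized_supermartingale ::
  "'a measure \<Rightarrow> (nat \<Rightarrow> 'a) measure \<Rightarrow> (nat \<Rightarrow> (nat \<Rightarrow> 'a) \<Rightarrow> real) \<Rightarrow> bool" where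
  "generalized_supermartingale M P L \<longleftrightarrow>
     (\<forall>t. L t \<in> borel_measurable (nat_filtration M t)) \<and>
     (\<forall>t. gen_cond_exp_exists P (nat_filtration M t) (L (Suc t))) \<and>
     (\<forall>t. AE \<omega> in P. gen_cond_exp P (nat_filtration M t) (L (Suc t)) \<omega> \<le> ereal (L t \<omega>))"

lemma subalgebra_nat_filtration:
  assumes "law M P"
  shows "subalgebra P (nat_filtration M t)"
proof -
  have sP: "sets P = sets (seq_space M)" and spP: "space P = space (seq_space M)"
    using assms sets_eq_imp_space_eq by (auto simp: law_def)
  have sub: "{(\<lambda>\<omega>. \<omega> i) -` A \<inter> space (seq_space M) | i A. i \<in> {1..t} \<and> A \<in> sets M}
      \<subseteq> sets (seq_space M)"
  proof clarify
    fix i A assume "i \<in> {1..t}" "A \<in> sets M"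
    moreover from this have "(\<lambda>\<omega>. \<omega> i) \<in> measurable (seq_space M) M"
      unfolding seq_space_def by (intro measurable_component_singleton) auto
    ultimately show "(\<lambda>\<omega>. \<omega> i) -` A \<inter> space (seq_space M) \<in> sets (seq_space M)"
      by (auto intro: measurable_sets)
  qed
  have pow: "{(\<lambda>\<omega>. \<omega> i) -` A \<inter> space (seq_space M) | i A. i \<in> {1..t} \<and> A \<in> sets M}
      \<subseteq> Pow (space (seq_space M))" by auto
  show ?thesis
    unfolding subalgebra_def nat_filtration_def sP spP
      space_measure_of[OF pow] sets_measure_of[OF pow]
    using sets.sigma_sets_subset[OF sub] by blast
qed

text \<open>Generalized supermartingales extend integrable ones.\<close>

lemma supermartingale_imp_generalized:
  assumes P: "law M P" and L: "supermartingale M P L"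
  shows "generalized_supermartingale M P L"
proof -
  interpret prob_space P using P by (simp add: law_def)
  have fin: "AE \<omega> in P. nn_cond_exp P (nat_filtration M t) (\<lambda>x. ennreal (f x)) \<omega> < \<infinity>"
    if f: "integrable P f" for f :: "(nat \<Rightarrow> 'a) \<Rightarrow> real" and t
  proof -
    interpret finite_measure_subalgebra P "nat_filtration M t"
      by unfold_locales (rule subalgebra_nat_filtration[OF P])
    have m[measurable]: "f \<in> borel_measurable P" using f by simp
    have "(\<integral>\<^sup>+ x. nn_cond_exp P (nat_filtration M t) (\<lambda>x. ennreal (f x)) x \<partial>P)
        = (\<integral>\<^sup>+ x. ennreal (f x) \<partial>P)"
      using nn_cond_exp_intg[of "\<lambda>_. 1" "\<lambda>x. ennreal (f x)"] by simp
    also have "\<dots> \<le> (\<integral>\<^sup>+ x. ennreal (norm (f x)) \<partial>P)"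
      by (intro nn_integral_mono ennreal_leI) auto
    also have "\<dots> < \<infinity>" using f by (simp add: integrable_iff_bounded)
    finally have "(\<integral>\<^sup>+ x. nn_cond_exp P (nat_filtration M t) (\<lambda>x. ennreal (f x)) x \<partial>P) \<noteq> \<infinity>"
      by auto
    from nn_integral_PInf_AE[OF _ this] show ?thesis
      by (simp add: top.not_eq_extremum)
  qed
  have pos: "AE \<omega> in P. nn_cond_exp P (nat_filtration M t) (\<lambda>x. ennreal (L (Suc t) x)) \<omega> < \<infinity>"
   and neg: "AE \<omega> in P. nn_cond_exp P (nat_filtration M t) (\<lambda>x. ennreal (- L (Suc t) x)) \<omega> < \<infinity>"
    for t
    using L fin[of "L (Suc t)" t] fin[of "\<lambda>x. - L (Suc t) x" t]
    by (auto simp: supermartingale_def)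
  have "AE \<omega> in P. gen_cond_exp P (nat_filtration M t) (L (Suc t)) \<omega> \<le> ereal (L t \<omega>)" for t
  proof -
    have "AE \<omega> in P. real_cond_exp P (nat_filtration M t) (L (Suc t)) \<omega> \<le> L t \<omega>"
      using L by (auto simp: supermartingale_def)
    with pos[of t] neg[of t] show ?thesis
    proof eventually_elim
      case (elim \<omega>)
      have e: "enn2ereal x = ereal (enn2real x)" if "x < \<infinity>" for x
        using that by (cases x) auto
      show ?case using elim by (simp add: gen_cond_exp_def real_cond_exp_def e)
    qed
  qed
  moreover have "gen_cond_exp_exists P (nat_filtration M t) (L (Suc t))" for t
    unfolding gen_cond_exp_exists_def using pos[of t] by eventually_elim simp
  ultimately show ?thesis
    using L by (auto simp: generalized_supermartingale_def supermartingale_def)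
qed

end

theory Submission
  imports Defs
begin

text \<open>By Bayes' rule, \<open>Z\<^sub>t E\<^sub>P[f | F\<^sub>t] = E\<^sub>R[Z\<^sub>t\<^sub>+\<^sub>1 f | F\<^sub>t]\<close> for nonnegative \<open>f\<close>. On the two consecutive times
  \<open>t, t+1\<close> the fork process is a combination \<open>a Z + b Z'\<close> with the same nonnegative
  \<open>F\<^sub>t\<close>-measurable coefficients, so \<open>Z''\<^sub>t E''[f | F\<^sub>t] = a Z\<^sub>t E[f | F\<^sub>t] + b Z'\<^sub>t E'[f | F\<^sub>t]\<close>, and the
  one-step inequality passes from \<open>Q\<close> and \<open>Q'\<close> to \<open>Q''\<close>. If the negative parts are integrable,
  then so are the positive parts, by induction on \<open>t\<close> from the constant \<open>L\<^sub>0\<close>, and the tower property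
  extends the inequality to several steps.\<close>

section \<open>Change of measure for conditional expectations\<close>

text \<open>Isolates one time of a likelihood ratio process. The one-step argument then needs only
  two nested sigma-algebras \<open>F\<close> and \<open>G\<close>, and densities valued in
  \<open>ennreal\<close> keep it free of integrability conditions.\<close>

definition restr_density :: "'a measure \<Rightarrow> 'a measure \<Rightarrow> 'a measure \<Rightarrow> ('a \<Rightarrow> ennreal) \<Rightarrow> bool" where
  "restr_density R F P z \<longleftrightarrow>
     prob_space R \<and> prob_space P \<and> subalgebra R F \<and> subalgebra P F \<and> z \<in> borel_measurable F
     \<and> density (restr_to_subalg R F) z = restr_to_subalg P F"

lemma restr_density_nn_integral:
  assumes P: "restr_density R F P z" and [measurable]: "f \<in> borel_measurable F"
  shows "(\<integral>\<^sup>+x. f x \<partial>P) = (\<integral>\<^sup>+x. z x * f x \<partial>R)"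
proof -
  have RF: "subalgebra R F" and PF: "subalgebra P F" and z[measurable]: "z \<in> borel_measurable F"
    and d: "density (restr_to_subalg R F) z = restr_to_subalg P F"
    using P by (auto simp: restr_density_def)
  have "(\<integral>\<^sup>+x. f x \<partial>P) = (\<integral>\<^sup>+x. f x \<partial>density (restr_to_subalg R F) z)"
    using nn_integral_subalgebra2[OF PF, of f] by (simp add: d)
  also have "\<dots> = (\<integral>\<^sup>+x. z x * f x \<partial>restr_to_subalg R F)"
    by (intro nn_integral_density measurable_in_subalg[OF RF]) auto
  also have "\<dots> = (\<integral>\<^sup>+x. z x * f x \<partial>R)"
    by (intro nn_integral_subalgebra2[OF RF]) simp
  finally show ?thesis .
qed

text \<open>A property that holds almost everywhere under \<open>P\<close> survives the restriction
  to \<open>F\<close> only if its exceptional set is covered by a null set from \<open>F\<close>.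
  Measurability of \<open>S\<close> with respect to \<open>F\<close> makes the exceptional set
  itself such a cover.\<close>

lemma restr_density_AE_iff:
  assumes P: "restr_density R F P z" and S[measurable]: "Measurable.pred F S"
  shows "(AE x in P. S x) \<longleftrightarrow> (AE x in R. 0 < z x \<longrightarrow> S x)"
proof -
  have RF: "subalgebra R F" and PF: "subalgebra P F" and z[measurable]: "z \<in> borel_measurable F"
    and d: "density (restr_to_subalg R F) z = restr_to_subalg P F"
    using P by (auto simp: restr_density_def)
  have "(AE x in P. S x) \<longleftrightarrow> (AE x in restr_to_subalg P F. S x)"
    using AE_restr_to_subalg[OF PF] AE_restr_to_subalg2[OF PF _ S] by blast
  also have "\<dots> \<longleftrightarrow> (AE x in restr_to_subalg R F. 0 < z x \<longrightarrow> S x)"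
    unfolding d[symmetric] by (intro AE_density measurable_in_subalg[OF RF z])
  also have "\<dots> \<longleftrightarrow> (AE x in R. 0 < z x \<longrightarrow> S x)"
  proof
    assume "AE x in R. 0 < z x \<longrightarrow> S x"
    then show "AE x in restr_to_subalg R F. 0 < z x \<longrightarrow> S x"
      by (rule AE_restr_to_subalg2[OF RF]) measurable
  qed (rule AE_restr_to_subalg[OF RF])
  finally show ?thesis .
qed

text \<open>Both sides are compared by integrating over sets of \<open>F\<close>. The density
  \<open>z1\<close> on \<open>G\<close> carries the integral of \<open>f\<close> from
  \<open>R\<close> to \<open>P\<close>, the conditional expectation replaces \<open>f\<close> there,
  and since it is measurable for \<open>F\<close>, the density \<open>z\<close> carries the integral
  back. The product form needs no division by \<open>z\<close>, which may vanish.\<close>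

lemma restr_density_bayes:
  assumes P: "restr_density R F P z" and P1: "restr_density R G P z1"
    and FG: "subalgebra G F" and f[measurable]: "f \<in> borel_measurable G"
  shows "AE x in R. z x * nn_cond_exp P F f x = nn_cond_exp R F (\<lambda>x. z1 x * f x) x"
proof -
  have RF: "subalgebra R F" and PF: "subalgebra P F" and z[measurable]: "z \<in> borel_measurable F"
    and "prob_space R" "prob_space P" and RG: "subalgebra R G" and PG: "subalgebra P G"
    and z1[measurable]: "z1 \<in> borel_measurable G"
    using P P1 by (auto simp: restr_density_def)
  interpret R: prob_space R by fact
  interpret P: prob_space P by fact
  interpret R: finite_measure_subalgebra R F by unfold_locales fact
  interpret P: finite_measure_subalgebra P F by unfold_locales fact
  have fP[measurable]: "f \<in> borel_measurable P" and fR[measurable]: "f \<in> borel_measurable R"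
    and [measurable]: "z1 \<in> borel_measurable R"
    using measurable_from_subalg RG PG f z1 by blast+
  show ?thesis
  proof (rule R.nn_cond_exp_charact)
    fix A assume A[measurable]: "A \<in> sets F"
    then have [measurable]: "A \<in> sets G" using FG by (auto simp: subalgebra_def)
    have "(\<integral>\<^sup>+x\<in>A. (z1 x * f x) \<partial>R) = (\<integral>\<^sup>+x. z1 x * (f x * indicator A x) \<partial>R)"
      by (simp add: mult.assoc)
    also have "\<dots> = (\<integral>\<^sup>+x. f x * indicator A x \<partial>P)"
      by (rule restr_density_nn_integral[OF P1, symmetric]) simp
    also have "\<dots> = (\<integral>\<^sup>+x. indicator A x * f x \<partial>P)"
      by (simp add: mult.commute)
    also have "\<dots> = (\<integral>\<^sup>+x. indicator A x * nn_cond_exp P F f x \<partial>P)"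
      by (rule P.nn_cond_exp_intg[symmetric]) auto
    also have "\<dots> = (\<integral>\<^sup>+x. z x * (indicator A x * nn_cond_exp P F f x) \<partial>R)"
      by (rule restr_density_nn_integral[OF P]) simp
    also have "\<dots> = (\<integral>\<^sup>+x\<in>A. (z x * nn_cond_exp P F f x) \<partial>R)"
      by (simp add: ac_simps)
    finally show "(\<integral>\<^sup>+x\<in>A. (z1 x * f x) \<partial>R) = (\<integral>\<^sup>+x\<in>A. (z x * nn_cond_exp P F f x) \<partial>R)" .
  qed measurable
qed

text \<open>Bayes' rule expresses all three conditional expectations under the single measure
  \<open>R\<close>, where conditioning is additive and the coefficients \<open>a\<close>,
  \<open>b\<close>, known in \<open>F\<close>, move inside. It is essential that the same
  coefficients combine the densities on \<open>F\<close> and on \<open>G\<close>.\<close>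

lemma restr_density_bayes_combination:
  assumes Q: "restr_density R F Q z" "restr_density R G Q z1"
    and Q': "restr_density R F Q' z'" "restr_density R G Q' z1'"
    and Q'': "restr_density R F Q'' (\<lambda>x. a x * z x + b x * z' x)"
      "restr_density R G Q'' (\<lambda>x. a x * z1 x + b x * z1' x)"
    and FG: "subalgebra G F" and f[measurable]: "f \<in> borel_measurable G"
    and a[measurable]: "a \<in> borel_measurable F" and b[measurable]: "b \<in> borel_measurable F"
  shows "AE x in R. (a x * z x + b x * z' x) * nn_cond_exp Q'' F f x
     = a x * z x * nn_cond_exp Q F f x + b x * z' x * nn_cond_exp Q' F f x"
proof -
  have RF: "subalgebra R F" and RG: "subalgebra R G" and "prob_space R"
    and z1: "z1 \<in> borel_measurable G" and z1': "z1' \<in> borel_measurable G"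
    using Q Q' by (auto simp: restr_density_def)
  interpret R: prob_space R by fact
  interpret R: finite_measure_subalgebra R F by unfold_locales fact
  have [measurable]: "f \<in> borel_measurable R" "z1 \<in> borel_measurable R" "z1' \<in> borel_measurable R"
    "a \<in> borel_measurable R" "b \<in> borel_measurable R"
    using measurable_from_subalg RG RF f z1 z1' a b by blast+
  have eq: "(\<lambda>x. (a x * z1 x + b x * z1' x) * f x)
      = (\<lambda>x. a x * (z1 x * f x) + b x * (z1' x * f x))"
    by (simp add: algebra_simps)
  have 1: "AE x in R. a x * nn_cond_exp R F (\<lambda>x. z1 x * f x) x
      = nn_cond_exp R F (\<lambda>x. a x * (z1 x * f x)) x"
    by (rule R.nn_cond_exp_prod) auto
  have 2: "AE x in R. b x * nn_cond_exp R F (\<lambda>x. z1' x * f x) x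
      = nn_cond_exp R F (\<lambda>x. b x * (z1' x * f x)) x"
    by (rule R.nn_cond_exp_prod) auto
  have 3: "AE x in R. nn_cond_exp R F (\<lambda>x. a x * (z1 x * f x)) x
       + nn_cond_exp R F (\<lambda>x. b x * (z1' x * f x)) x
      = nn_cond_exp R F (\<lambda>x. (a x * z1 x + b x * z1' x) * f x) x"
    unfolding eq by (rule R.nn_cond_exp_sum) auto
  show ?thesis
    using 1 2 3 restr_density_bayes[OF Q FG f] restr_density_bayes[OF Q' FG f]
      restr_density_bayes[OF Q'' FG f]
    by eventually_elim (simp add: mult.assoc)
qed

section \<open>The one-step inequality and its nonnegative combinations\<close>

text \<open>Moving the negative parts to the other side avoids differences of infinite quantities and
  yields an inequality that is preserved under nonnegative combinations.\<close>

lemma ereal_diff_le_iff_ennreal: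
  fixes p n :: ennreal and l :: real
  shows "(p < \<infinity> \<or> n < \<infinity>) \<and> enn2ereal p - enn2ereal n \<le> ereal l
     \<longleftrightarrow> p < \<infinity> \<and> p + ennreal (- l) \<le> ennreal l + n"
proof (cases p; cases n)
  fix u v :: real assume u: "0 \<le> u" "p = ennreal u" and v: "0 \<le> v" "n = ennreal v"
  \<comment> \<open>\<open>ennreal l\<close> and \<open>ennreal (- l)\<close> are the positive and
    the negative part of \<open>l\<close>, so moving terms across leaves
    \<open>u - v <= l\<close>.\<close>
  have "p + ennreal (- l) \<le> ennreal l + n \<longleftrightarrow> u + max 0 (- l) \<le> max 0 l + v"
    using u v by (cases "0 \<le> l") (auto simp: ennreal_neg simp flip: ennreal_plus)
  then show ?thesis using u v by auto
\<comment> \<open>Infinite cases: if \<open>p\<close> is infinite, both sides of the equivalence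
  fail; if only \<open>n\<close> is, the difference is minus infinity and both sides hold.\<close>
qed (auto simp: top_unique)

text \<open>Existence turns into finiteness for the positive part: were it infinite and the negative
  part finite, the difference would be infinite and exceed the real number
  \<open>L t x\<close>.\<close>

lemma generalized_supermartingale_iff:
  "generalized_supermartingale M P L \<longleftrightarrow>
     (\<forall>t. L t \<in> borel_measurable (nat_filtration M t)) \<and>
     (\<forall>t. AE x in P. nn_cond_exp P (nat_filtration M t) (\<lambda>x. ennreal (L (Suc t) x)) x < \<infinity> \<and>
        nn_cond_exp P (nat_filtration M t) (\<lambda>x. ennreal (L (Suc t) x)) x + ennreal (- L t x)
          \<le> ennreal (L t x) + nn_cond_exp P (nat_filtration M t) (\<lambda>x. ennreal (- L (Suc t) x)) x)"
  unfolding generalized_supermartingale_def gen_cond_exp_exists_def gen_cond_exp_def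
    ereal_diff_le_iff_ennreal[symmetric] AE_conj_iff
  by blast

text \<open>The inequality under \<open>Q\<close> is weighted by \<open>a z\<close>, the one under
  \<open>Q'\<close> by \<open>b z'\<close>, and the two are added. By Bayes' rule the sum is the
  inequality under \<open>Q''\<close> times the total weight, which is finite by \<open>fin\<close>
  and positive almost everywhere under \<open>Q''\<close>, and so can be cancelled.\<close>

lemma supermartingale_step_combination:
  fixes f :: "'a \<Rightarrow> real" and l :: "'a \<Rightarrow> real"
  defines "step \<equiv> \<lambda>P F x. nn_cond_exp P F (\<lambda>x. ennreal (f x)) x < \<infinity> \<and>
        nn_cond_exp P F (\<lambda>x. ennreal (f x)) x + ennreal (- l x)
          \<le> ennreal (l x) + nn_cond_exp P F (\<lambda>x. ennreal (- f x)) x"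
  assumes Q: "restr_density R F Q z" "restr_density R G Q z1"
    and Q': "restr_density R F Q' z'" "restr_density R G Q' z1'"
    and Q'': "restr_density R F Q'' (\<lambda>x. a x * z x + b x * z' x)"
      "restr_density R G Q'' (\<lambda>x. a x * z1 x + b x * z1' x)"
    and fin: "\<And>x. a x * z x + b x * z' x < \<infinity>"
    and FG: "subalgebra G F" and f[measurable]: "f \<in> borel_measurable G"
    and l[measurable]: "l \<in> borel_measurable F"
    and a: "a \<in> borel_measurable F" and b: "b \<in> borel_measurable F"
    and stepQ: "AE x in Q. step Q F x" and stepQ': "AE x in Q'. step Q' F x"
  shows "AE x in Q''. step Q'' F x"
proof -
  have [measurable]: "Measurable.pred F (step P F)" for P
    unfolding step_def by measurable
  note R = restr_density_AE_iff[OF Q(1)] restr_density_AE_iff[OF Q'(1)]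
    restr_density_AE_iff[OF Q''(1)]
  have "AE x in R. 0 < z x \<longrightarrow> step Q F x" "AE x in R. 0 < z' x \<longrightarrow> step Q' F x"
    using stepQ stepQ' R(1)[of "step Q F"] R(2)[of "step Q' F"] by simp_all
  moreover have pos: "AE x in R. (a x * z x + b x * z' x) * nn_cond_exp Q'' F (\<lambda>x. ennreal (f x)) x
     = a x * z x * nn_cond_exp Q F (\<lambda>x. ennreal (f x)) x
       + b x * z' x * nn_cond_exp Q' F (\<lambda>x. ennreal (f x)) x"
    by (rule restr_density_bayes_combination[OF Q Q' Q'' FG _ a b]) simp
  moreover have neg: "AE x in R. (a x * z x + b x * z' x) * nn_cond_exp Q'' F (\<lambda>x. ennreal (- f x)) x
     = a x * z x * nn_cond_exp Q F (\<lambda>x. ennreal (- f x)) x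
       + b x * z' x * nn_cond_exp Q' F (\<lambda>x. ennreal (- f x)) x"
    by (rule restr_density_bayes_combination[OF Q Q' Q'' FG _ a b]) simp
  ultimately have "AE x in R. 0 < a x * z x + b x * z' x \<longrightarrow> step Q'' F x"
  proof eventually_elim
    case (elim x)
    define u v where "u = a x * z x" and "v = b x * z' x"
    define p p' p'' where "p = nn_cond_exp Q F (\<lambda>x. ennreal (f x)) x"
      and "p' = nn_cond_exp Q' F (\<lambda>x. ennreal (f x)) x"
      and "p'' = nn_cond_exp Q'' F (\<lambda>x. ennreal (f x)) x"
    define n n' n'' where "n = nn_cond_exp Q F (\<lambda>x. ennreal (- f x)) x"
      and "n' = nn_cond_exp Q' F (\<lambda>x. ennreal (- f x)) x"
      and "n'' = nn_cond_exp Q'' F (\<lambda>x. ennreal (- f x)) x"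
    note defs = u_def v_def p_def p'_def p''_def n_def n'_def n''_def
    have uv: "u + v < \<infinity>" using fin[of x] by (simp add: defs)
    have P: "(u + v) * p'' = u * p + v * p'" and N: "(u + v) * n'' = u * n + v * n'"
      using elim by (simp_all add: defs)
    \<comment> \<open>Where \<open>u = 0\<close> all terms vanish, also infinite ones, since 0 times
      infinity is 0 in \<open>ennreal\<close>. Elsewhere \<open>z x\<close> is positive, so the
      inequality under \<open>Q\<close> is available at \<open>x\<close>.\<close>
    have s: "u * p < \<infinity> \<and> u * p + u * ennreal (- l x) \<le> u * ennreal (l x) + u * n"
    proof (cases "u = 0")
      case False
      then have "0 < z x" by (auto simp: u_def zero_less_iff_neq_zero)
      with elim have 1: "p < \<infinity>" and 2: "p + ennreal (- l x) \<le> ennreal (l x) + n"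
        by (auto simp: defs step_def)
      show ?thesis using 1 mult_left_mono[OF 2, of u] uv
        by (simp add: distrib_left ennreal_mult_less_top)
    qed simp
    have s': "v * p' < \<infinity> \<and> v * p' + v * ennreal (- l x) \<le> v * ennreal (l x) + v * n'"
    proof (cases "v = 0")
      case False
      then have "0 < z' x" by (auto simp: v_def zero_less_iff_neq_zero)
      with elim have 1: "p' < \<infinity>" and 2: "p' + ennreal (- l x) \<le> ennreal (l x) + n'"
        by (auto simp: defs step_def)
      show ?thesis using 1 mult_left_mono[OF 2, of v] uv
        by (simp add: distrib_left ennreal_mult_less_top)
    qed simp
    show ?case
    proof
      assume "0 < a x * z x + b x * z' x"
      then have uv0: "0 < u + v" by (simp add: defs)
      have "(u + v) * p'' < \<infinity>" using s s' by (simp add: P)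
      then have p'': "p'' < \<infinity>" using uv0
        by (auto simp: ennreal_mult_less_top)
      have "(u + v) * (p'' + ennreal (- l x))
          = (u * p + u * ennreal (- l x)) + (v * p' + v * ennreal (- l x))"
        unfolding distrib_left P by (simp add: algebra_simps)
      also have "\<dots> \<le> (u * ennreal (l x) + u * n) + (v * ennreal (l x) + v * n')"
        using s s' by (blast intro: add_mono)
      also have "\<dots> = (u + v) * (ennreal (l x) + n'')"
        unfolding distrib_left N by (simp add: algebra_simps)
      finally have "p'' + ennreal (- l x) \<le> ennreal (l x) + n''"
        using uv0 uv by (subst (asm) ennreal_mult_le_mult_iff) auto
      with p'' show "step Q'' F x" by (simp add: step_def defs)
    qed
  qed
  then show ?thesis using R(3)[of "step Q'' F"] by simp
qed

section \<open>The natural filtration and the fork process\<close>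

lemma subalgebra_nat_filtration_mono:
  assumes "s \<le> t"
  shows "subalgebra (nat_filtration M t) (nat_filtration M s)"
proof -
  have pow: "{(\<lambda>\<omega>. \<omega> i) -` A \<inter> space (seq_space M) | i A. i \<in> {1..t} \<and> A \<in> sets M}
      \<subseteq> Pow (space (seq_space M))" for t :: nat by auto
  show ?thesis
    unfolding subalgebra_def nat_filtration_def space_measure_of[OF pow] sets_measure_of[OF pow]
    using assms by (intro conjI refl sigma_sets_mono') fastforce
qed

lemma space_nat_filtration [simp]: "space (nat_filtration M t) = space (seq_space M)"
  unfolding nat_filtration_def by (rule space_measure_of) auto

lemma sets_nat_filtration_0: "sets (nat_filtration M 0) = {{}, space (seq_space M)}"
  unfolding nat_filtration_def by (simp add: sigma_sets_empty_eq)

text \<open>The preimage of a value attained is a nonempty set of the trivial sigma-algebra, hence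
  the whole space. This makes the initial value of an adapted process constant, the start of the
  integrability induction.\<close>

lemma nat_filtration_0_const:
  assumes f: "(f :: (nat \<Rightarrow> 'a) \<Rightarrow> real) \<in> borel_measurable (nat_filtration M 0)"
  shows "\<exists>c. \<forall>x\<in>space (seq_space M). f x = c"
proof (rule ccontr)
  assume n: "\<nexists>c. \<forall>x\<in>space (seq_space M). f x = c"
  then obtain x where x: "x \<in> space (seq_space M)" by blast
  with n obtain y where y: "y \<in> space (seq_space M)" "f y \<noteq> f x" by blast
  have "f -` {f x} \<inter> space (nat_filtration M 0) \<in> sets (nat_filtration M 0)"
    using f by (rule measurable_sets) simp
  then show False using x y by (auto simp: sets_nat_filtration_0)
qed

text \<open>No single step straddles the fork: either both times are at most \<open>s\<close>, with
  weights 1 and 0, or both are at least \<open>s\<close>, with weights \<open>h\<close> and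
  \<open>(1 - h) Z s / Z' s\<close>, which are known at time \<open>s\<close>.\<close>

lemma fork_process_linear_step:
  assumes Z: "likelihood_ratio_process M R Q Z" and Z': "likelihood_ratio_process M R Q' Z'"
    and h: "h \<in> borel_measurable (nat_filtration M s)"
    and h01: "\<And>\<omega>. \<omega> \<in> space (seq_space M) \<Longrightarrow> 0 \<le> h \<omega> \<and> h \<omega> \<le> 1"
    and h1: "\<And>\<omega>. \<omega> \<in> space (seq_space M) \<Longrightarrow> Z' s \<omega> = 0 \<Longrightarrow> h \<omega> = 1"
  obtains a b :: "(nat \<Rightarrow> 'a) \<Rightarrow> real" where
    "a \<in> borel_measurable (nat_filtration M t)" "b \<in> borel_measurable (nat_filtration M t)"
    "\<And>\<omega>. \<omega> \<in> space (seq_space M) \<Longrightarrow> 0 \<le> a \<omega> \<and> 0 \<le> b \<omega>"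
    "\<And>\<omega> k. \<omega> \<in> space (seq_space M) \<Longrightarrow> k \<in> {t, Suc t} \<Longrightarrow>
        fork_process s h Z Z' k \<omega> = a \<omega> * Z k \<omega> + b \<omega> * Z' k \<omega>"
proof (cases "t < s")
  case True
  show ?thesis
    by (rule that[of "\<lambda>_. 1" "\<lambda>_. 0"]) (use True in \<open>auto simp: fork_process_def\<close>)
next
  case False
  then have st: "s \<le> t" by simp
  \<comment> \<open>junk value 0 where \<open>Z' s\<close> vanishes, which is harmless as \<open>h = 1\<close> there\<close>
  define c where "c \<omega> = (1 - h \<omega>) * Z s \<omega> / Z' s \<omega>" for \<omega>
  have nn: "0 \<le> Z s \<omega> \<and> 0 \<le> Z' s \<omega>" if "\<omega> \<in> space (seq_space M)" for \<omega>
    using Z Z' that by (auto simp: likelihood_ratio_process_def)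
  have [measurable]: "Z s \<in> borel_measurable (nat_filtration M s)"
    "Z' s \<in> borel_measurable (nat_filtration M s)" "h \<in> borel_measurable (nat_filtration M s)"
    using Z Z' h by (auto simp: likelihood_ratio_process_def)
  have "c \<in> borel_measurable (nat_filtration M s)"
    unfolding c_def by measurable
  then have m: "c \<in> borel_measurable (nat_filtration M t)" "h \<in> borel_measurable (nat_filtration M t)"
    using measurable_from_subalg[OF subalgebra_nat_filtration_mono[OF st]] h by blast+
  show ?thesis
  proof (rule that[of h c])
    show "0 \<le> h \<omega> \<and> 0 \<le> c \<omega>" if "\<omega> \<in> space (seq_space M)" for \<omega>
      using nn[OF that] h01[OF that] by (auto simp: c_def)
    show "fork_process s h Z Z' k \<omega> = h \<omega> * Z k \<omega> + c \<omega> * Z' k \<omega>"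
      if "\<omega> \<in> space (seq_space M)" "k \<in> {t, Suc t}" for \<omega> k
    proof (cases "Z' s \<omega> = 0")
      case True
      with h1[OF that(1)] show ?thesis by (auto simp: fork_process_def c_def)
    next
      case f: False
      show ?thesis
      \<comment> \<open>At the fork time itself the first branch of \<open>fork_process\<close>
        applies; the weights reproduce it because the quotient cancels and
        \<open>h Z s + (1 - h) Z s = Z s\<close>.\<close>
      proof (cases "k = s")
        case True
        with f show ?thesis by (simp add: fork_process_def c_def) (simp add: algebra_simps)
      next
        case False
        with that st f show ?thesis by (auto simp: fork_process_def c_def ratio_def)
      qed
    qed
  qed (use m in auto)
qed

section \<open>Fork-convex combinations of generalized supermartingales\<close>

lemma likelihood_ratio_process_restr_density:
  assumes "law M R" "law M P" "likelihood_ratio_process M R P Z"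
  shows "restr_density R (nat_filtration M t) P (\<lambda>\<omega>. ennreal (Z t \<omega>))"
proof -
  have [measurable]: "Z t \<in> borel_measurable (nat_filtration M t)"
    using assms(3) by (auto simp: likelihood_ratio_process_def)
  show ?thesis
    using assms subalgebra_nat_filtration[of M R t] subalgebra_nat_filtration[of M P t]
    by (auto simp: restr_density_def likelihood_ratio_process_def law_def)
qed

lemma restr_density_cong:
  assumes "restr_density R F P z" "\<And>x. x \<in> space F \<Longrightarrow> z x = w x"
  shows "restr_density R F P w"
proof -
  have RF: "subalgebra R F" and z[measurable]: "z \<in> borel_measurable F"
    using assms by (auto simp: restr_density_def)
  have w: "w \<in> borel_measurable F"
    using z assms(2) measurable_cong[of F z w borel] by simp
  have "density (restr_to_subalg R F) w = density (restr_to_subalg R F) z"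
    using RF assms(2) by (intro density_cong measurable_in_subalg[OF RF] w z AE_I2)
      (auto simp: space_restr_to_subalg subalgebra_def)
  with assms(1) w show ?thesis by (auto simp: restr_density_def)
qed

lemma generalized_supermartingale_fork_convex:
  assumes R: "law M R" and Q: "law M Q" and Q': "law M Q'"
    and fork: "fork_convex_combination M R Q Q' Q''"
    and LQ: "generalized_supermartingale M Q L" and LQ': "generalized_supermartingale M Q' L"
  shows "generalized_supermartingale M Q'' L"
  unfolding generalized_supermartingale_iff
proof (intro conjI allI)
  show L: "L t \<in> borel_measurable (nat_filtration M t)" for t
    using LQ by (auto simp: generalized_supermartingale_def)
  fix t
  obtain Z Z' s h where
    Z: "likelihood_ratio_process M R Q Z" and Z': "likelihood_ratio_process M R Q' Z'"
    and h: "h \<in> borel_measurable (nat_filtration M s)"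
      "\<And>\<omega>. \<omega> \<in> space (seq_space M) \<Longrightarrow> 0 \<le> h \<omega> \<and> h \<omega> \<le> 1"
      "\<And>\<omega>. \<omega> \<in> space (seq_space M) \<Longrightarrow> Z' s \<omega> = 0 \<Longrightarrow> h \<omega> = 1"
    and Z'': "likelihood_ratio_process M R Q'' (fork_process s h Z Z')"
    and Q'': "law M Q''"
    using fork unfolding fork_convex_combination_def by blast
  obtain a b :: "(nat \<Rightarrow> 'a) \<Rightarrow> real" where
    ab: "a \<in> borel_measurable (nat_filtration M t)" "b \<in> borel_measurable (nat_filtration M t)"
      "\<And>\<omega>. \<omega> \<in> space (seq_space M) \<Longrightarrow> 0 \<le> a \<omega> \<and> 0 \<le> b \<omega>"
    and eq: "\<And>\<omega> k. \<omega> \<in> space (seq_space M) \<Longrightarrow> k \<in> {t, Suc t} \<Longrightarrow>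
        fork_process s h Z Z' k \<omega> = a \<omega> * Z k \<omega> + b \<omega> * Z' k \<omega>"
    using fork_process_linear_step[OF Z Z' h] by metis
  have d'': "restr_density R (nat_filtration M k) Q''
      (\<lambda>\<omega>. ennreal (a \<omega>) * ennreal (Z k \<omega>) + ennreal (b \<omega>) * ennreal (Z' k \<omega>))"
    if k: "k \<in> {t, Suc t}" for k
  \<comment> \<open>Passing from \<open>real\<close> to \<open>ennreal\<close> respects these sums
    and products for nonnegative terms, and the signs are known only on the sequence space; hence a
    congruence restricted to the space.\<close>
  proof (rule restr_density_cong[OF likelihood_ratio_process_restr_density[OF R Q'' Z'']])
    fix \<omega> assume "\<omega> \<in> space (nat_filtration M k)"
    then have w: "\<omega> \<in> space (seq_space M)" by simp
    have nn: "0 \<le> Z k \<omega>" "0 \<le> Z' k \<omega>" "0 \<le> a \<omega>" "0 \<le> b \<omega>"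
      using Z Z' w ab(3)[OF w] by (auto simp: likelihood_ratio_process_def)
    show "ennreal (fork_process s h Z Z' k \<omega>)
        = ennreal (a \<omega>) * ennreal (Z k \<omega>) + ennreal (b \<omega>) * ennreal (Z' k \<omega>)"
      using nn by (simp add: eq[OF w k] ennreal_mult)
  qed
  note d = likelihood_ratio_process_restr_density[OF R Q Z]
    and d' = likelihood_ratio_process_restr_density[OF R Q' Z']
  show "AE x in Q''. nn_cond_exp Q'' (nat_filtration M t) (\<lambda>x. ennreal (L (Suc t) x)) x < \<infinity> \<and>
      nn_cond_exp Q'' (nat_filtration M t) (\<lambda>x. ennreal (L (Suc t) x)) x + ennreal (- L t x)
      \<le> ennreal (L t x) + nn_cond_exp Q'' (nat_filtration M t) (\<lambda>x. ennreal (- L (Suc t) x)) x"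
  \<comment> \<open>Each density fact enters twice: at time \<open>t\<close> for \<open>F\<close>
    and at time \<open>Suc t\<close> for \<open>G\<close>.\<close>
  proof (rule supermartingale_step_combination[where G = "nat_filtration M (Suc t)",
        OF d d d' d' d'' d''])
    show "subalgebra (nat_filtration M (Suc t)) (nat_filtration M t)"
      by (rule subalgebra_nat_filtration_mono) simp
  qed (use L ab LQ LQ' in \<open>auto simp: generalized_supermartingale_iff ennreal_mult_less_top\<close>)
qed

section \<open>From generalized to integrable supermartingales\<close>

lemma generalized_imp_supermartingale:
  assumes P: "law M P" and L: "generalized_supermartingale M P L"
    and neg: "\<And>t. integrable P (\<lambda>\<omega>. max 0 (- L t \<omega>))"
  shows "supermartingale M P L"
proof -
  interpret prob_space P using P by (simp add: law_def)
  have sub: "subalgebra P (nat_filtration M t)" for t by (rule subalgebra_nat_filtration[OF P])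
  have sp: "space P = space (seq_space M)"
    using P sets_eq_imp_space_eq by (auto simp: law_def)
  have cond: "finite_measure_subalgebra P (nat_filtration M t)" for t
    by unfold_locales (rule sub)
  have LF: "L t \<in> borel_measurable (nat_filtration M t)" for t
    using L by (auto simp: generalized_supermartingale_def)
  then have LP[measurable]: "L t \<in> borel_measurable P" for t
    using measurable_from_subalg[OF sub] by blast
  have step: "AE x in P. nn_cond_exp P (nat_filtration M t) (\<lambda>x. ennreal (L (Suc t) x)) x < \<infinity> \<and>
      nn_cond_exp P (nat_filtration M t) (\<lambda>x. ennreal (L (Suc t) x)) x + ennreal (- L t x)
      \<le> ennreal (L t x) + nn_cond_exp P (nat_filtration M t) (\<lambda>x. ennreal (- L (Suc t) x)) x" for t
    using L by (auto simp: generalized_supermartingale_iff)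
  have int_nce: "(\<integral>\<^sup>+x. nn_cond_exp P (nat_filtration M t) f x \<partial>P) = (\<integral>\<^sup>+x. f x \<partial>P)"
    if "f \<in> borel_measurable P" for f t
  proof -
    interpret finite_measure_subalgebra P "nat_filtration M t" by (rule cond)
    show ?thesis using nn_cond_exp_intg[of "\<lambda>_. 1" f] that by simp
  qed
  have negfin: "(\<integral>\<^sup>+x. ennreal (- L t x) \<partial>P) < \<infinity>" for t
  proof -
    have "(\<integral>\<^sup>+x. ennreal (- L t x) \<partial>P) = (\<integral>\<^sup>+x. ennreal (norm (max 0 (- L t x))) \<partial>P)"
      by (intro nn_integral_cong) (auto simp: max_def ennreal_neg)
    also have "\<dots> < \<infinity>" using neg[of t] by (simp only: integrable_iff_bounded)
    finally show ?thesis .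
  qed
  have posfin: "(\<integral>\<^sup>+x. ennreal (L t x) \<partial>P) < \<infinity>" for t
  proof (induction t)
    case 0
    obtain c where c: "\<forall>x\<in>space (seq_space M). L 0 x = c"
      using nat_filtration_0_const[OF LF] by blast
    have "(\<integral>\<^sup>+x. ennreal (L 0 x) \<partial>P) = (\<integral>\<^sup>+x. ennreal c \<partial>P)"
      by (intro nn_integral_cong) (simp add: c sp)
    then show ?case by (simp add: emeasure_space_1)
  next
    case (Suc t)
    have "(\<integral>\<^sup>+x. ennreal (L (Suc t) x) \<partial>P)
        = (\<integral>\<^sup>+x. nn_cond_exp P (nat_filtration M t) (\<lambda>x. ennreal (L (Suc t) x)) x \<partial>P)"
      by (rule int_nce[symmetric]) simp
    \<comment> \<open>Dropping the negative part of \<open>L t\<close> from the left of the one-step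
      inequality leaves a bound whose integral is the positive part at \<open>t\<close> plus the
      negative part at \<open>Suc t\<close>: the former is finite by induction, the latter by
      assumption.\<close>
    also have "\<dots> \<le> (\<integral>\<^sup>+x. ennreal (L t x)
        + nn_cond_exp P (nat_filtration M t) (\<lambda>x. ennreal (- L (Suc t) x)) x \<partial>P)"
    proof (intro nn_integral_mono_AE)
      show "AE x in P. nn_cond_exp P (nat_filtration M t) (\<lambda>x. ennreal (L (Suc t) x)) x
        \<le> ennreal (L t x) + nn_cond_exp P (nat_filtration M t) (\<lambda>x. ennreal (- L (Suc t) x)) x"
        using step[of t]
        by (rule eventually_mono) (metis add_increasing2 order_refl order_trans zero_le)
    qed
    also have "\<dots> = (\<integral>\<^sup>+x. ennreal (L t x) \<partial>P) + (\<integral>\<^sup>+x. ennreal (- L (Suc t) x) \<partial>P)"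
      by (simp add: nn_integral_add int_nce)
    also have "\<dots> < \<infinity>" using Suc negfin by simp
    finally show ?case .
  qed
  have int: "integrable P (L t)" for t
  proof (rule integrableI_bounded)
    have "(\<integral>\<^sup>+x. ennreal (norm (L t x)) \<partial>P) = (\<integral>\<^sup>+x. ennreal (L t x) + ennreal (- L t x) \<partial>P)"
      by (intro nn_integral_cong) (auto simp: abs_if ennreal_neg)
    also have "\<dots> < \<infinity>" using posfin negfin by (simp add: nn_integral_add)
    finally show "(\<integral>\<^sup>+x. ennreal (norm (L t x)) \<partial>P) < \<infinity>" .
  qed simp
  have one: "AE x in P. real_cond_exp P (nat_filtration M t) (L (Suc t)) x \<le> L t x" for t
  proof -
    \<comment> \<open>\<open>real_cond_exp\<close> is a difference of real values, so the inequality
      can be read back only where both conditional expectations are finite. For the positive part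
      this is contained in \<open>step\<close>; for the negative part it follows from the finite
      integral.\<close>
    have "(\<integral>\<^sup>+x. nn_cond_exp P (nat_filtration M t) (\<lambda>x. ennreal (- L (Suc t) x)) x \<partial>P) \<noteq> \<infinity>"
      using negfin[of "Suc t"] by (subst int_nce) auto
    from nn_integral_PInf_AE[OF _ this]
    have "AE x in P. nn_cond_exp P (nat_filtration M t) (\<lambda>x. ennreal (- L (Suc t) x)) x \<noteq> \<infinity>"
      by simp
    then show ?thesis using step[of t]
    proof eventually_elim
      case (elim x)
      have e: "enn2ereal y = ereal (enn2real y)" if "y < \<infinity>" for y
        using that by (cases y) auto
      from elim(2)[folded ereal_diff_le_iff_ennreal] elim show ?case
        by (simp add: real_cond_exp_def e top.not_eq_extremum)
    qed
  qed
  \<comment> \<open>Induction on the later time: the one-step inequality from \<open>n\<close> to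
    \<open>Suc n\<close> is conditioned on the past up to \<open>s\<close>, and the tower property
    removes the inner conditioning.\<close>
  have "AE x in P. real_cond_exp P (nat_filtration M s) (L t) x \<le> L s x" if "s \<le> t" for s t
    using that
  proof (induction t rule: dec_induct)
    case base
    interpret finite_measure_subalgebra P "nat_filtration M s" by (rule cond)
    show ?case using real_cond_exp_F_meas[OF int LF] by eventually_elim simp
  next
    case (step n)
    interpret finite_measure_subalgebra P "nat_filtration M s" by (rule cond)
    interpret n: finite_measure_subalgebra P "nat_filtration M n" by (rule cond)
    have "AE x in P. real_cond_exp P (nat_filtration M s)
        (real_cond_exp P (nat_filtration M n) (L (Suc n))) x
        \<le> real_cond_exp P (nat_filtration M s) (L n) x"
      by (intro real_cond_exp_mono one int n.real_cond_exp_int)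
    moreover have "AE x in P. real_cond_exp P (nat_filtration M s)
        (real_cond_exp P (nat_filtration M n) (L (Suc n))) x
        = real_cond_exp P (nat_filtration M s) (L (Suc n)) x"
      using step by (intro real_cond_exp_nested_subalg sub subalgebra_nat_filtration_mono int)
    ultimately show ?case using step.IH by eventually_elim simp
  qed
  with LF int show ?thesis by (auto simp: supermartingale_def)
qed

text \<open>Integrability may be lost under \<open>Q''\<close>, which is why there are two forms.
  The second goes through the first: integrable supermartingales are generalized ones, and
  integrable negative parts under \<open>Q''\<close> lead back. That condition holds, for instance,
  when \<open>L\<close> is nonnegative.\<close>

theorem lemma12:
  fixes M :: "'a measure"
    and R Q Q' Q'' :: "(nat \<Rightarrow> 'a) measure"
    and L :: "nat \<Rightarrow> (nat \<Rightarrow> 'a) \<Rightarrow> real"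
  assumes "law M R" and "law M Q" and "law M Q'"
    and "fork_convex_combination M R Q Q' Q''"
  shows "(generalized_supermartingale M Q L \<and> generalized_supermartingale M Q' L
            \<longrightarrow> generalized_supermartingale M Q'' L)
       \<and> (supermartingale M Q L \<and> supermartingale M Q' L
            \<and> (\<forall>t. integrable Q'' (\<lambda>\<omega>. max 0 (- L t \<omega>)))
            \<longrightarrow> supermartingale M Q'' L)"
proof -
  have "law M Q''" using assms(4) by (simp add: fork_convex_combination_def)
  then show ?thesis
    using generalized_supermartingale_fork_convex[OF assms] generalized_imp_supermartingale
      supermartingale_imp_generalized[OF assms(2)] supermartingale_imp_generalized[OF assms(3)]
    by blast
qed

end
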